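(* There exists a one-sided error $\alpha$-erasure-resilient $\varepsilon$-tester for monotonicity of real-valued functions on the line $[n]=\{1,\dots,n\}$ that works for all $\alpha,\varepsilon\in(0,1)$, with query complexity $O\!\left(\frac{\log n}{\varepsilon(1-\alpha)}\right)$.
   Context: For a domain $\mathcal{D}$, range $\mathcal{R}$ and $\alpha\in(0,1)$, a function $f:\mathcal{D}\to\mathcal{R}\cup\{\perp\}$ is $\alpha$-erased if $f$ evaluates to $\perp$ on at most an $\alpha$ fraction of $\mathcal{D}$; such points are erased and the set of nonerased points is $\mathcal{N}$. A restoration of $f$ is a function $f':\mathcal{D}\to\mathcal{R}$ agreeing with $f$ on $\mathcal{N}$. An $\alpha$-erasure-resilient $\varepsilon$-tester for a property $\mathcal{P}$ gets $\alpha,\varepsilon$ and oracle access to an $\alpha$-erased $f$ (a query at $x$ returns $f(x)$, possibly $\perp$; the tester does not know $\mathcal{N}$ in advance) and, with probability at least $2/3$, accepts if some restoration of $f$ satisfies $\mathcal{P}$, and rejects if every restoration of $f$ must be changed on at least an $\varepsilon$ fraction of the points of $\mathcal{N}$ to satisfy $\mathcal{P}$. It has one-sided error if it accepts with probability 1 in the first case. Query complexity is the worst case number of queries over all $\alpha$-erased inputs. A function $f:[n]\to\mathbb{R}$ is monotone if $x<y$ implies $f(x)\le f(y)$. *)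

theory Defs
  imports "HOL-Probability.Probability"
begin

text \<open>
  A deterministic adaptive query algorithm is a decision tree: it either stops with a verdict
  (\<open>True\<close> = accept), or queries a point and continues depending on the value it receives.
  A randomized algorithm draws its coins in advance, i.e. it is a distribution over such trees.
\<close>

datatype ('x, 'v) query_tree =
    Verdict bool
  | Query 'x "'v \<Rightarrow> ('x, 'v) query_tree"

type_synonym ('x, 'v) query_algorithm = "('x, 'v) query_tree pmf"

primrec verdict :: "('x \<Rightarrow> 'v) \<Rightarrow> ('x, 'v) query_tree \<Rightarrow> bool" where
  "verdict f (Verdict b) = b"
| "verdict f (Query x k) = verdict f (k (f x))"

primrec queries :: "('x \<Rightarrow> 'v) \<Rightarrow> ('x, 'v) query_tree \<Rightarrow> 'x list" where
  "queries f (Verdict b) = []"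
| "queries f (Query x k) = x # queries f (k (f x))"

definition prob_accept :: "('x, 'v) query_algorithm \<Rightarrow> ('x \<Rightarrow> 'v) \<Rightarrow> real" where
  "prob_accept T f = measure_pmf.prob T {t. verdict f t}"

definition prob_reject :: "('x, 'v) query_algorithm \<Rightarrow> ('x \<Rightarrow> 'v) \<Rightarrow> real" where
  "prob_reject T f = measure_pmf.prob T {t. \<not> verdict f t}"

text \<open>
  A partially erased function on a finite domain \<open>D\<close> is a function into an option type, with
  \<open>None\<close> in the role of the erasure symbol. Values outside \<open>D\<close> are irrelevant.
\<close>

definition erased :: "'x set \<Rightarrow> real \<Rightarrow> ('x \<Rightarrow> 'r option) \<Rightarrow> bool" where
  "erased D \<alpha> f \<longleftrightarrow> real (card {x \<in> D. f x = None}) \<le> \<alpha> * real (card D)"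

definition nonerased :: "'x set \<Rightarrow> ('x \<Rightarrow> 'r option) \<Rightarrow> 'x set" where
  "nonerased D f = {x \<in> D. f x \<noteq> None}"

definition restoration :: "'x set \<Rightarrow> ('x \<Rightarrow> 'r option) \<Rightarrow> ('x \<Rightarrow> 'r) \<Rightarrow> bool" where
  "restoration D f f' \<longleftrightarrow> (\<forall>x \<in> nonerased D f. f x = Some (f' x))"

definition restorable ::
    "'x set \<Rightarrow> (('x \<Rightarrow> 'r) \<Rightarrow> bool) \<Rightarrow> ('x \<Rightarrow> 'r option) \<Rightarrow> bool" where
  "restorable D P f \<longleftrightarrow> (\<exists>f'. restoration D f f' \<and> P f')"

definition far ::
    "'x set \<Rightarrow> (('x \<Rightarrow> 'r) \<Rightarrow> bool) \<Rightarrow> real \<Rightarrow> ('x \<Rightarrow> 'r option) \<Rightarrow> bool" where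
  "far D P \<epsilon> f \<longleftrightarrow>
     (\<forall>f'. restoration D f f' \<longrightarrow>
        (\<forall>g. P g \<longrightarrow>
           \<epsilon> * real (card (nonerased D f)) \<le> real (card {x \<in> nonerased D f. g x \<noteq> f' x})))"

definition erasure_resilient_tester ::
    "'x set \<Rightarrow> (('x \<Rightarrow> 'r) \<Rightarrow> bool) \<Rightarrow> real \<Rightarrow> real \<Rightarrow> ('x, 'r option) query_algorithm \<Rightarrow> bool" where
  "erasure_resilient_tester D P \<alpha> \<epsilon> T \<longleftrightarrow>
     (\<forall>f. erased D \<alpha> f \<longrightarrow>
        (\<forall>t \<in> set_pmf T. set (queries f t) \<subseteq> D) \<and>
        (restorable D P f \<longrightarrow> prob_accept T f \<ge> 2 / 3) \<and>
        (far D P \<epsilon> f \<longrightarrow> prob_reject T f \<ge> 2 / 3))"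

definition one_sided ::
    "'x set \<Rightarrow> (('x \<Rightarrow> 'r) \<Rightarrow> bool) \<Rightarrow> real \<Rightarrow> ('x, 'r option) query_algorithm \<Rightarrow> bool" where
  "one_sided D P \<alpha> T \<longleftrightarrow>
     (\<forall>f. erased D \<alpha> f \<longrightarrow> restorable D P f \<longrightarrow> prob_accept T f = 1)"

text \<open>The worst case is over the inputs and over the coins of the algorithm.\<close>

definition query_complexity ::
    "'x set \<Rightarrow> real \<Rightarrow> ('x, 'r option) query_algorithm \<Rightarrow> enat" where
  "query_complexity D \<alpha> T =
     (SUP f \<in> {f. erased D \<alpha> f}. SUP t \<in> set_pmf T. enat (length (queries f t)))"

end

theory Submission
  imports Defs
begin

text \<open>
  Fix an ordering of the points and let it define a binary search tree: its first nonerased point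
  is the root, and the points on either side of a root are searched recursively. Search for a
  uniformly random \<open>s\<close> and reject if a pivot on the way violates monotonicity with \<open>s\<close>. Any two
  points whose searches succeed are separated by a common pivot (or one is a pivot for the other),
  so \<open>f\<close> is monotone on these points; hence for every ordering the searches of at least an
  \<open>\<epsilon>\<close> fraction of the nonerased points fail.

  With a uniformly random ordering, \<open>z\<close> is queried in the search for \<open>s\<close> only if it comes first
  among \<open>z\<close> and the nonerased points between \<open>z\<close> and \<open>s\<close>. The inverse sizes of these sets sum,
  over all nonerased \<open>s\<close>, to at most twice a harmonic number, whether or not \<open>z\<close> is erased. So one
  search takes \<open>O(log n)\<close> queries on average and rejects with probability at least
  \<open>\<epsilon> (1 - \<alpha>)\<close>. Repeating it \<open>O(1 / (\<epsilon> (1 - \<alpha>)))\<close> times amplifies this probability, and by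
  Markov's inequality the total number of queries may be cut off at a multiple of its expectation.
\<close>

section \<open>Preliminaries: extending monotone functions\<close>

text \<open>The running maximum of the values on \<open>G\<close> is monotone and, as
  \<open>f\<close> is monotone on \<open>G\<close>, attained at the current point. This turns a set
  of mutually consistent points into a competitor against which farness can be applied.\<close>

lemma mono_on_extension:
  fixes f :: "'a::linorder \<Rightarrow> 'r::linorder"
  assumes "finite G" and mono: "mono_on G f"
  shows "\<exists>g. mono g \<and> (\<forall>x\<in>G. g x = f x)"
proof -
  \<comment> \<open>\<open>undefined\<close> only keeps the set nonempty. The value \<open>c\<close>
    lies below all values on \<open>G\<close> and serves the points to the left of
    \<open>G\<close>.\<close>
  define c where "c = Min (insert undefined (f ` G))"
  define g where "g x = Max (insert c (f ` {y \<in> G. y \<le> x}))" for x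
  have "mono g"
  proof (rule monoI)
    fix x y :: 'a
    assume "x \<le> y"
    then show "g x \<le> g y"
      unfolding g_def using \<open>finite G\<close> by (intro Max_mono) auto
  qed
  moreover have "g x = f x" if "x \<in> G" for x
    unfolding g_def
  proof (rule Max_eqI)
    show "finite (insert c (f ` {y \<in> G. y \<le> x}))"
      using \<open>finite G\<close> by simp
    show "f x \<in> insert c (f ` {y \<in> G. y \<le> x})"
      using that by simp
    have "c \<le> f x"
      unfolding c_def using that \<open>finite G\<close> by (intro Min_le) auto
    then show "b \<le> f x" if "b \<in> insert c (f ` {y \<in> G. y \<le> x})" for b
      using that \<open>x \<in> G\<close> mono_onD[OF mono] by auto
  qed
  ultimately show ?thesis
    by blast
qed

lemma find_filter:
  assumes "\<And>x. P x \<Longrightarrow> Q x"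
  shows "find P (filter Q xs) = find P xs"
  by (induction xs) (use assms in auto)

section \<open>Truncating and combining decision trees\<close>

text \<open>An exhausted budget leads to acceptance, so truncation can only turn rejections into
  acceptances and preserves one-sided error.\<close>

primrec truncate_tree :: "('x, 'v) query_tree \<Rightarrow> nat \<Rightarrow> ('x, 'v) query_tree" where
  "truncate_tree (Verdict b) = (\<lambda>m. Verdict b)"
| "truncate_tree (Query x k) =
     (\<lambda>m. case m of 0 \<Rightarrow> Verdict True | Suc m' \<Rightarrow> Query x (\<lambda>v. truncate_tree (k v) m'))"

lemma length_queries_truncate_tree: "length (queries f (truncate_tree t m)) \<le> m"
  by (induction t arbitrary: m) (auto split: nat.split)

lemma set_queries_truncate_tree: "set (queries f (truncate_tree t m)) \<subseteq> set (queries f t)"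
proof (induction t arbitrary: m)
  case (Query x k)
  have "set (queries f (truncate_tree (k (f x)) m')) \<subseteq> set (queries f (k (f x)))" for m'
    by (rule Query.IH) simp
  then show ?case
    by (auto split: nat.split)
qed simp

lemma verdict_truncate_tree: "verdict f t \<Longrightarrow> verdict f (truncate_tree t m)"
  by (induction t arbitrary: m) (auto split: nat.split)

lemma verdict_truncate_tree_eq:
  "length (queries f t) \<le> m \<Longrightarrow> verdict f (truncate_tree t m) = verdict f t"
  by (induction t arbitrary: m) (auto split: nat.split)

primrec conj_tree :: "('x, 'v) query_tree \<Rightarrow> ('x, 'v) query_tree \<Rightarrow> ('x, 'v) query_tree" where
  "conj_tree (Verdict b) u = (if b then u else Verdict False)"
| "conj_tree (Query x k) u = Query x (\<lambda>v. conj_tree (k v) u)"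

lemma verdict_conj_tree: "verdict f (conj_tree t u) \<longleftrightarrow> verdict f t \<and> verdict f u"
  by (induction t) auto

lemma length_queries_conj_tree:
  "length (queries f (conj_tree t u)) \<le> length (queries f t) + length (queries f u)"
  by (induction t) auto

lemma set_queries_conj_tree:
  "set (queries f (conj_tree t u)) \<subseteq> set (queries f t) \<union> set (queries f u)"
  by (induction t) auto

definition conj_trees :: "('x, 'v) query_tree list \<Rightarrow> ('x, 'v) query_tree" where
  "conj_trees ts = foldr conj_tree ts (Verdict True)"

lemma verdict_conj_trees: "verdict f (conj_trees ts) \<longleftrightarrow> (\<forall>t\<in>set ts. verdict f t)"
  by (induction ts) (auto simp: conj_trees_def verdict_conj_tree)

lemma length_queries_conj_trees:
  "length (queries f (conj_trees ts)) \<le> (\<Sum>t\<leftarrow>ts. length (queries f t))"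
proof (induction ts)
  case (Cons t ts)
  then show ?case
    using length_queries_conj_tree[of f t "conj_trees ts"] by (simp add: conj_trees_def)
qed (simp add: conj_trees_def)

lemma set_queries_conj_trees:
  "set (queries f (conj_trees ts)) \<subseteq> (\<Union>t\<in>set ts. set (queries f t))"
proof (induction ts)
  case (Cons t ts)
  then show ?case
    using set_queries_conj_tree[of f t "conj_trees ts"] by (auto simp: conj_trees_def)
qed (simp add: conj_trees_def)

section \<open>Searching for a point under a fixed ordering\<close>

text \<open>The search tree is never built: the list holds the remaining candidates for pivots in
  their order, its first nonerased entry is the root of the current subtree, and filtering by the
  side of \<open>s\<close> descends. The argument \<open>a\<close> is the value at
  \<open>s\<close>.\<close>

fun search_tree ::
    "'a::linorder \<Rightarrow> 'r::linorder \<Rightarrow> 'a list \<Rightarrow> ('a, 'r option) query_tree" where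
  "search_tree s a [] = Verdict True"
| "search_tree s a (z # zs) = Query z (\<lambda>v. case v of
       None \<Rightarrow> search_tree s a zs
     | Some b \<Rightarrow>
         if z = s then Verdict True
         else if (if z < s then b \<le> a else a \<le> b)
         then search_tree s a (filter (\<lambda>y. z < y \<longleftrightarrow> z < s) zs)
         else Verdict False)"

text \<open>The value at \<open>s\<close> is needed at every pivot, so \<open>s\<close> is queried
  ahead of the search. An erased \<open>s\<close> gives no evidence against monotonicity.\<close>

definition point_test_tree :: "'a::linorder \<Rightarrow> 'a list \<Rightarrow> ('a, 'r::linorder option) query_tree" where
  "point_test_tree s xs = Query s (\<lambda>v. case v of
       None \<Rightarrow> Verdict True | Some a \<Rightarrow> search_tree s a xs)"

text \<open>This follows the recursion of the search, which continues with the tail after an erased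
  entry and with a filtered tail after a pivot. Both are shorter than the list.\<close>

lemma list_filter_induct [case_names Nil Cons]:
  assumes "P []"
    and "\<And>z zs. P zs \<Longrightarrow> (\<And>Q. P (filter Q zs)) \<Longrightarrow> P (z # zs)"
  shows "P xs"
proof (induction xs rule: length_induct)
  case (1 xs)
  show ?case
  proof (cases xs)
    case (Cons z zs)
    then have "P zs"
      using 1 by simp
    moreover have "length (filter Q zs) < length xs" for Q
      using Cons by (simp add: le_imp_less_Suc)
    then have "P (filter Q zs)" for Q
      using 1 by blast
    ultimately show ?thesis
      using assms(2) Cons by simp
  qed (simp add: assms(1))
qed

lemma set_queries_search_tree: "set (queries f (search_tree s a xs)) \<subseteq> set xs"
proof (induction xs rule: list_filter_induct)
  case (Cons z zs)
  have "set (queries f (search_tree s a (filter Q zs))) \<subseteq> set zs" for Q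
    using Cons.IH(2)[of Q] by auto
  then show ?case
    using Cons.IH(1) by (auto simp del: set_filter split: option.split)
qed simp

text \<open>A queried point leaves the list for good. Hence counting queries amounts to counting
  queried points.\<close>

lemma distinct_queries_search_tree:
  "distinct xs \<Longrightarrow> distinct (queries f (search_tree s a xs))"
proof (induction xs rule: list_filter_induct)
  case (Cons z zs)
  have "z \<notin> set (queries f (search_tree s a zs))"
    using set_queries_search_tree[of f s a zs] Cons.prems by auto
  moreover have "z \<notin> set (queries f (search_tree s a (filter Q zs)))" for Q
    using set_queries_search_tree[of f s a "filter Q zs"] Cons.prems by auto
  moreover have "distinct (queries f (search_tree s a (filter Q zs)))" for Q
    using Cons by simp
  ultimately show ?case
    using Cons by (auto split: option.split)
qed simp

text \<open>The source of one-sided error: every comparison made by the search is an instance of the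
  assumption.\<close>

lemma verdict_search_tree_if_mono:
  assumes "\<forall>x\<in>set xs. \<forall>b. f x = Some b \<longrightarrow> (x \<le> s \<longrightarrow> b \<le> a) \<and> (s \<le> x \<longrightarrow> a \<le> b)"
  shows "verdict f (search_tree s a xs)"
  using assms
proof (induction xs rule: list_filter_induct)
  case (Cons z zs)
  have "verdict f (search_tree s a (filter Q zs))" for Q
    by (rule Cons.IH(2)) (use Cons.prems in auto)
  then show ?case
    using Cons by (auto split: option.split)
qed simp

text \<open>The pivot that separates the searches for \<open>x\<close> and \<open>y\<close> lies between them and has been
  compared with both.\<close>

lemma search_tree_consistent:
  assumes "x \<in> set xs" "y \<in> set xs" "x < y" "f x = Some a" "f y = Some b"
    and "verdict f (search_tree x a xs)" "verdict f (search_tree y b xs)"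
  shows "a \<le> b"
  using assms(1,2,6,7)
proof (induction xs rule: list_filter_induct)
  case (Cons z zs)
  show ?case
  proof (cases "f z")
    case None
    then show ?thesis
      using Cons.IH(1) Cons.prems assms by auto
  next
    case (Some c)
    consider "z = x" | "z = y" | "z \<noteq> x" "z \<noteq> y" "x < z" "z < y"
      | "z \<noteq> x" "z \<noteq> y" "z < x \<longleftrightarrow> z < y"
      using \<open>x < y\<close> by fastforce
    then show ?thesis
    proof cases
      case 3
      then show ?thesis
        using Cons.prems Some by (auto split: if_splits)
    next
      case 4
      \<comment> \<open>Since \<open>x\<close> and \<open>y\<close> are on the same side of
        \<open>z\<close>, both searches continue with this same list.\<close>
      let ?zs = "filter (\<lambda>w. z < w \<longleftrightarrow> z < x) zs"
      have "verdict f (search_tree x a ?zs)" "verdict f (search_tree y b ?zs)"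
        using Cons.prems Some 4 by (simp_all split: if_splits)
      moreover have "x \<in> set ?zs" "y \<in> set ?zs"
        using Cons.prems 4 by auto
      ultimately show ?thesis
        using Cons.IH(2) by blast
    qed (use Cons.prems Some assms in \<open>auto split: if_splits\<close>)
  qed
qed simp

section \<open>The points reached by a search\<close>

definition segment :: "'a::linorder \<Rightarrow> 'a \<Rightarrow> 'a set" where
  "segment x y = {min x y..max x y}"

text \<open>A search for \<open>s\<close> reaches \<open>z\<close> only if no nonerased pivot has separated them before.\<close>

lemma find_if_in_queries_search_tree:
  assumes "z \<in> set (queries f (search_tree s a xs))"
  shows "find (\<lambda>x. x = z \<or> x \<in> segment z s \<and> f x \<noteq> None) xs = Some z"
  using assms
proof (induction xs rule: list_filter_induct)
  case (Cons h zs)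
  show ?case
  proof (cases "h = z \<or> f h = None")
    case True
    then show ?thesis
      using Cons by auto
  next
    case False
    let ?Q = "\<lambda>y. h < y \<longleftrightarrow> h < s"
    have "h \<noteq> s" and z: "z \<in> set (queries f (search_tree s a (filter ?Q zs)))"
      using Cons.prems False by (auto split: if_splits)
    have "?Q z"
      using set_queries_search_tree[of f s a "filter ?Q zs"] z by auto
    with \<open>h \<noteq> s\<close> False have sides: "h < z \<and> h < s \<or> z < h \<and> s < h"
      by auto
    \<comment> \<open>All points between \<open>z\<close> and \<open>s\<close> lie on their common
      side of \<open>h\<close>. So \<open>h\<close> does not count for \<open>find\<close>, and the
      filter removes no entry that does.\<close>
    then have "h \<notin> segment z s"
      by (auto simp: segment_def min_def max_def)
    moreover have "find (\<lambda>x. x = z \<or> x \<in> segment z s \<and> f x \<noteq> None) (filter ?Q zs)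
        = find (\<lambda>x. x = z \<or> x \<in> segment z s \<and> f x \<noteq> None) zs"
      using sides by (intro find_filter) (auto simp: segment_def min_def max_def split: if_splits)
    ultimately show ?thesis
      using Cons.IH(2)[OF z] False by simp
  qed
qed simp

section \<open>Random orderings and harmonic sums\<close>

lemma find_map_inj:
  assumes "inj g"
  shows "find (\<lambda>x. x \<in> g ` A) (map g xs) = map_option g (find (\<lambda>x. x \<in> A) xs)"
  by (induction xs) (auto simp: inj_image_mem_iff[OF assms])

text \<open>By symmetry, each element of \<open>A\<close> is equally likely to come first: swapping
  \<open>a\<close> with \<open>b\<close> maps the orderings led by \<open>a\<close> within
  \<open>A\<close> injectively to those led by \<open>b\<close>. These classes are disjoint.\<close>

lemma card_permutations_first:
  assumes "finite D" "A \<subseteq> D" "a \<in> A"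
  shows "card A * card {xs \<in> permutations_of_set D. find (\<lambda>x. x \<in> A) xs = Some a}
    \<le> fact (card D)"
proof -
  define E where "E b = {xs \<in> permutations_of_set D. find (\<lambda>x. x \<in> A) xs = Some b}" for b
  have fin: "finite (E b)" for b
    by (simp add: E_def)
  have le: "card (E a) \<le> card (E b)" if "b \<in> A" for b
  proof (rule card_inj_on_le)
    let ?g = "Transposition.transpose a b"
    show "inj_on (map ?g) (E a)"
      by (rule inj_on_subset[OF inj_mapI]) simp_all
    have "a \<in> D" "b \<in> D"
      using assms that by auto
    then have A: "?g ` A = A" and D: "?g ` D = D"
      using assms that by simp_all
    have "map ?g xs \<in> E b" if "xs \<in> E a" for xs
    proof -
      have "find (\<lambda>x. x \<in> A) (map ?g xs) = Some b"
        using find_map_inj[of ?g A xs] that by (simp add: A E_def)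
      moreover have "map ?g xs \<in> permutations_of_set D"
        using that D by (auto simp: E_def permutations_of_set_def distinct_map)
      ultimately show ?thesis
        by (simp add: E_def)
    qed
    then show "map ?g ` E a \<subseteq> E b"
      by blast
  qed (rule fin)
  have "card A * card (E a) = (\<Sum>b\<in>A. card (E a))"
    by simp
  also have "\<dots> \<le> (\<Sum>b\<in>A. card (E b))"
    by (intro sum_mono le)
  also have "\<dots> = card (\<Union>b\<in>A. E b)"
    using assms fin by (intro card_UN_disjoint[symmetric]) (auto simp: E_def intro: finite_subset)
  also have "\<dots> \<le> card (permutations_of_set D)"
    by (intro card_mono) (auto simp: E_def)
  also have "\<dots> = fact (card D)"
    using assms by simp
  finally show ?thesis
    by (simp add: E_def)
qed

text \<open>The ranks are exactly 1, ..., \<open>card A\<close>. A new maximum takes the next rank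
  and leaves the others unchanged.\<close>

lemma sum_inverse_rank_le:
  fixes A :: "'a::linorder set"
  assumes "finite A"
  shows "(\<Sum>s\<in>A. 1 / real (card {x \<in> A. x \<le> s})) = harm (card A)"
  using assms
proof (induction A rule: finite_linorder_max_induct)
  case (insert b A)
  have "b \<notin> A" using insert by auto
  have "{x \<in> insert b A. x \<le> s} = {x \<in> A. x \<le> s}" if "s \<in> A" for s
    using insert that by force
  moreover have "{x \<in> insert b A. x \<le> b} = insert b A"
    using insert by force
  ultimately show ?case
    using insert \<open>b \<notin> A\<close> by (simp add: harm_Suc inverse_eq_divide)
qed (simp add: harm_def)

text \<open>The mirror image: ranks are counted from the top, and each step adds a new
  minimum.\<close>

lemma sum_inverse_rank_ge:
  fixes A :: "'a::linorder set"
  assumes "finite A"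
  shows "(\<Sum>s\<in>A. 1 / real (card {x \<in> A. s \<le> x})) = harm (card A)"
  using assms
proof (induction A rule: finite_linorder_min_induct)
  case (insert b A)
  have "b \<notin> A" using insert by auto
  have "{x \<in> insert b A. s \<le> x} = {x \<in> A. s \<le> x}" if "s \<in> A" for s
    using insert that by force
  moreover have "{x \<in> insert b A. b \<le> x} = insert b A"
    using insert by force
  ultimately show ?case
    using insert \<open>b \<notin> A\<close> by (simp add: harm_Suc inverse_eq_divide)
qed (simp add: harm_def)

text \<open>Split \<open>N\<close> at \<open>z\<close>. On either side, the number of points of
  \<open>N\<close> from \<open>z\<close> to \<open>s\<close> is at least the rank of
  \<open>s\<close> within that side, counted outwards from \<open>z\<close>, so each side
  contributes at most one harmonic number. Inserting \<open>z\<close> only enlarges the denominators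
  and covers an erased \<open>z\<close>.\<close>

lemma sum_inverse_card_segment:
  fixes N :: "'a::linorder set"
  assumes "finite N"
  shows "(\<Sum>s\<in>N. 1 / real (card (insert z (N \<inter> segment z s)))) \<le> 2 * harm (card N)"
proof -
  let ?h = "\<lambda>s. 1 / real (card (insert z (N \<inter> segment z s)))"
  have "sum ?h {s \<in> N. z \<le> s} \<le> (\<Sum>s | s \<in> N \<and> z \<le> s. 1 / real (card {x \<in> {s \<in> N. z \<le> s}. x \<le> s}))"
  proof (intro sum_mono)
    fix s assume s: "s \<in> {s \<in> N. z \<le> s}"
    have "card {x \<in> {s \<in> N. z \<le> s}. x \<le> s} \<le> card (insert z (N \<inter> segment z s))"
      using assms s by (intro card_mono) (auto simp: segment_def)
    moreover have "card {x \<in> {s \<in> N. z \<le> s}. x \<le> s} > 0"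
      using assms s by (auto simp: card_gt_0_iff)
    ultimately show "?h s \<le> 1 / real (card {x \<in> {s \<in> N. z \<le> s}. x \<le> s})"
      by (intro divide_left_mono) auto
  qed
  also have "\<dots> = harm (card {s \<in> N. z \<le> s})"
    using assms by (intro sum_inverse_rank_le) simp
  also have "\<dots> \<le> harm (card N)"
    using assms by (intro harm_mono card_mono) auto
  finally have ge: "sum ?h {s \<in> N. z \<le> s} \<le> harm (card N)" .
  have "sum ?h {s \<in> N. s < z} \<le> (\<Sum>s | s \<in> N \<and> s < z. 1 / real (card {x \<in> {s \<in> N. s < z}. s \<le> x}))"
  proof (intro sum_mono)
    fix s assume s: "s \<in> {s \<in> N. s < z}"
    have "card {x \<in> {s \<in> N. s < z}. s \<le> x} \<le> card (insert z (N \<inter> segment z s))"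
      using assms s by (intro card_mono) (auto simp: segment_def)
    moreover have "card {x \<in> {s \<in> N. s < z}. s \<le> x} > 0"
      using assms s by (auto simp: card_gt_0_iff)
    ultimately show "?h s \<le> 1 / real (card {x \<in> {s \<in> N. s < z}. s \<le> x})"
      by (intro divide_left_mono) auto
  qed
  also have "\<dots> = harm (card {s \<in> N. s < z})"
    using assms by (intro sum_inverse_rank_ge) simp
  also have "\<dots> \<le> harm (card N)"
    using assms by (intro harm_mono card_mono) auto
  finally have lt: "sum ?h {s \<in> N. s < z} \<le> harm (card N)" .
  have "sum ?h N = sum ?h ({s \<in> N. z \<le> s} \<union> {s \<in> N. s < z})"
    by (rule sum.cong) auto
  also have "\<dots> = sum ?h {s \<in> N. z \<le> s} + sum ?h {s \<in> N. s < z}"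
    using assms by (intro sum.union_disjoint) auto
  finally show ?thesis
    using ge lt by simp
qed

section \<open>The expected number of queries\<close>

text \<open>The summand 1 is the initial query to \<open>s\<close>. The queries of the search are
  distinct, and each goes to a point that comes first in the set named here.\<close>

lemma length_queries_point_test_tree:
  fixes f :: "'a::linorder \<Rightarrow> 'r::linorder option"
  assumes "finite D" "xs \<in> permutations_of_set D"
  shows "length (queries f (point_test_tree s xs)) \<le> 1 + (if f s = None then 0 else
    card {z \<in> D. find (\<lambda>x. x \<in> insert z (nonerased D f \<inter> segment z s)) xs = Some z})"
proof (cases "f s")
  case (Some a)
  let ?qs = "queries f (search_tree s a xs)"
  let ?F = "{z \<in> D. find (\<lambda>x. x \<in> insert z (nonerased D f \<inter> segment z s)) xs = Some z}"
  have xs: "set xs = D" "distinct xs"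
    using assms by (auto dest: permutations_of_setD)
  have "find (\<lambda>x. x \<in> insert z (nonerased D f \<inter> segment z s)) xs
      = find (\<lambda>x. x = z \<or> x \<in> segment z s \<and> f x \<noteq> None) xs" for z
    using xs by (intro find_cong) (auto simp: nonerased_def)
  then have "set ?qs \<subseteq> ?F"
    using set_queries_search_tree[of f s a xs] xs
    by (auto dest: find_if_in_queries_search_tree)
  then have "card (set ?qs) \<le> card ?F"
    using \<open>finite D\<close> by (intro card_mono) auto
  then show ?thesis
    using Some xs by (simp add: point_test_tree_def distinct_card distinct_queries_search_tree)
qed (simp add: point_test_tree_def)

text \<open>Double counting of triples \<open>(s, xs, z)\<close> for which \<open>z\<close> can be
  queried. The factor \<open>card D\<close> from summing over \<open>z\<close> is later cancelled by
  the uniform choice of \<open>s\<close>, so a single harmonic term remains on average.\<close>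

lemma sum_queries_point_test_tree:
  fixes f :: "'a::linorder \<Rightarrow> 'r::linorder option"
  assumes "finite D"
  shows "(\<Sum>(s, xs)\<in>D \<times> permutations_of_set D. real (length (queries f (point_test_tree s xs))))
    \<le> real (card D) * fact (card D) * (1 + 2 * harm (card D))"
proof -
  define N where "N = nonerased D f"
  define Ps where "Ps = permutations_of_set D"
  define A where "A z s = insert z (N \<inter> segment z s)" for z s
  define F where "F z s xs \<longleftrightarrow> find (\<lambda>x. x \<in> A z s) xs = Some z" for z s xs
  have N: "finite N" "N \<subseteq> D" "card N \<le> card D"
    using assms by (auto simp: N_def nonerased_def intro: card_mono)
  have [simp]: "finite Ps" "card Ps = fact (card D)"
    using assms by (simp_all add: Ps_def)
  have prob: "real (card {xs \<in> Ps. F z s xs}) \<le> fact (card D) * (1 / real (card (A z s)))"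
    if "z \<in> D" for z s
  proof -
    have "card (A z s) * card {xs \<in> Ps. F z s xs} \<le> fact (card D)"
      unfolding Ps_def F_def using that N assms
      by (intro card_permutations_first) (auto simp: A_def)
    then have "real (card (A z s)) * real (card {xs \<in> Ps. F z s xs}) \<le> fact (card D)"
      by (metis of_nat_fact of_nat_le_iff of_nat_mult)
    moreover have "card (A z s) > 0"
      using N by (simp add: A_def card_gt_0_iff)
    ultimately show ?thesis
      by (simp add: field_simps)
  qed
  have "(\<Sum>(s, xs)\<in>D \<times> Ps. real (length (queries f (point_test_tree s xs))))
      \<le> (\<Sum>(s, xs)\<in>D \<times> Ps. 1 + (if s \<in> N then real (card {z \<in> D. F z s xs}) else 0))"
  proof (intro sum_mono, clarify)
    fix s xs assume "s \<in> D" "xs \<in> Ps"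
    then have "length (queries f (point_test_tree s xs))
        \<le> 1 + (if s \<in> N then card {z \<in> D. F z s xs} else 0)"
      using length_queries_point_test_tree[OF assms, of xs f s]
      by (auto simp: Ps_def N_def nonerased_def F_def A_def)
    then show "real (length (queries f (point_test_tree s xs)))
        \<le> 1 + (if s \<in> N then real (card {z \<in> D. F z s xs}) else 0)"
      by (auto split: if_splits)
  qed
  also have "\<dots> = real (card D) * fact (card D)
      + (\<Sum>s\<in>D. \<Sum>xs\<in>Ps. if s \<in> N then real (card {z \<in> D. F z s xs}) else 0)"
    by (simp add: sum.cartesian_product[symmetric] sum.distrib)
  also have "(\<Sum>s\<in>D. \<Sum>xs\<in>Ps. if s \<in> N then real (card {z \<in> D. F z s xs}) else 0)
      = (\<Sum>s\<in>D. if s \<in> N then \<Sum>xs\<in>Ps. real (card {z \<in> D. F z s xs}) else 0)"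
    by (intro sum.cong) auto
  also have "\<dots> = (\<Sum>s\<in>N. \<Sum>xs\<in>Ps. real (card {z \<in> D. F z s xs}))"
    using N assms by (simp add: sum.inter_restrict[symmetric] Int_absorb1)
  also have "\<dots> = (\<Sum>s\<in>N. \<Sum>xs\<in>Ps. \<Sum>z\<in>D. of_bool (F z s xs))"
    using assms by (simp add: Int_def)
  \<comment> \<open>The orderings are summed innermost, where symmetry bounds their number. Then
    \<open>s\<close> is summed for fixed \<open>z\<close>, where the harmonic bound applies.\<close>
  also have "\<dots> = (\<Sum>s\<in>N. \<Sum>z\<in>D. \<Sum>xs\<in>Ps. of_bool (F z s xs))"
    by (intro sum.cong sum.swap refl)
  also have "\<dots> = (\<Sum>z\<in>D. \<Sum>s\<in>N. \<Sum>xs\<in>Ps. of_bool (F z s xs))"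
    by (rule sum.swap)
  also have "\<dots> = (\<Sum>z\<in>D. \<Sum>s\<in>N. real (card {xs \<in> Ps. F z s xs}))"
    by (simp add: Int_def)
  also have "\<dots> \<le> (\<Sum>z\<in>D. \<Sum>s\<in>N. fact (card D) * (1 / real (card (A z s))))"
    by (intro sum_mono prob)
  also have "\<dots> = (\<Sum>z\<in>D. fact (card D) * (\<Sum>s\<in>N. 1 / real (card (A z s))))"
    by (simp only: sum_distrib_left)
  also have "\<dots> \<le> (\<Sum>z\<in>D. fact (card D) * (2 * harm (card D)))"
  proof (intro sum_mono mult_left_mono)
    fix z
    have "(\<Sum>s\<in>N. 1 / real (card (A z s))) \<le> 2 * harm (card N)"
      unfolding A_def by (rule sum_inverse_card_segment) fact
    also have "\<dots> \<le> 2 * harm (card D)"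
      using N by (simp add: harm_mono)
    finally show "(\<Sum>s\<in>N. 1 / real (card (A z s))) \<le> 2 * harm (card D)" .
  qed simp
  finally show ?thesis
    by (simp add: Ps_def algebra_simps)
qed

section \<open>The rejection probability of one search\<close>

text \<open>By consistency of the searches, the restoration is monotone on the accepted nonerased
  points \<open>G\<close>. A monotone extension from \<open>G\<close> differs from it only at
  rejecting points, and farness bounds the number of differences from below.\<close>

lemma card_rejecting_points:
  fixes f :: "'a::linorder \<Rightarrow> 'r::linorder option"
  assumes "finite D" and far: "far D (mono_on D) \<epsilon> f" and "xs \<in> permutations_of_set D"
  shows "\<epsilon> * real (card (nonerased D f))
    \<le> real (card {s \<in> D. \<not> verdict f (point_test_tree s xs)})"
proof -
  \<comment> \<open>The arbitrary values at erased points are harmless, since \<open>far\<close>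
    counts changes on nonerased points only.\<close>
  define f' where "f' = (\<lambda>x. the (f x))"
  define G where "G = {s \<in> nonerased D f. verdict f (point_test_tree s xs)}"
  have "set xs = D"
    using assms by (auto dest: permutations_of_setD)
  have "mono_on G f'"
  proof (rule mono_onI)
    fix x y assume xy: "x \<in> G" "y \<in> G" "x \<le> y"
    show "f' x \<le> f' y"
    proof (cases "x = y")
      case False
      show ?thesis
        by (rule search_tree_consistent[of x xs y f])
          (use xy False \<open>set xs = D\<close> in \<open>auto simp: G_def f'_def nonerased_def point_test_tree_def\<close>)
    qed simp
  qed
  moreover have "finite G"
    using \<open>finite D\<close> by (simp add: G_def nonerased_def)
  ultimately obtain g where g: "mono g" "\<forall>x\<in>G. g x = f' x"
    using mono_on_extension[of G f'] by blast
  have "restoration D f f'"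
    by (auto simp: restoration_def nonerased_def f'_def)
  moreover have "mono_on D g"
    using g(1) by (auto intro: mono_on_subset)
  ultimately have "\<epsilon> * real (card (nonerased D f)) \<le> real (card {x \<in> nonerased D f. g x \<noteq> f' x})"
    using far by (simp add: far_def)
  also have "{x \<in> nonerased D f. g x \<noteq> f' x} \<subseteq> {s \<in> D. \<not> verdict f (point_test_tree s xs)}"
    using g(2) by (auto simp: G_def nonerased_def)
  then have "real (card {x \<in> nonerased D f. g x \<noteq> f' x})
      \<le> real (card {s \<in> D. \<not> verdict f (point_test_tree s xs)})"
    using \<open>finite D\<close> by (simp add: card_mono)
  finally show ?thesis .
qed

lemma card_nonerased:
  assumes "finite D" "erased D \<alpha> f"
  shows "(1 - \<alpha>) * real (card D) \<le> real (card (nonerased D f))"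
proof -
  have "card D = card (nonerased D f \<union> {x \<in> D. f x = None})"
    by (rule arg_cong[where f = card]) (auto simp: nonerased_def)
  also have "\<dots> = card (nonerased D f) + card {x \<in> D. f x = None}"
    using assms by (intro card_Un_disjoint) (auto simp: nonerased_def)
  finally have "real (card D) = real (card (nonerased D f)) + real (card {x \<in> D. f x = None})"
    by simp
  then show ?thesis
    using assms by (simp add: erased_def algebra_simps)
qed

definition point_test :: "'a::linorder set \<Rightarrow> ('a, 'r::linorder option) query_algorithm" where
  "point_test D =
     map_pmf (\<lambda>(s, xs). point_test_tree s xs) (pmf_of_set (D \<times> permutations_of_set D))"

lemma set_point_test:
  assumes "finite D" "D \<noteq> {}"
  shows "set_pmf (point_test D) = (\<lambda>(s, xs). point_test_tree s xs) ` (D \<times> permutations_of_set D)"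
  using assms by (auto simp: point_test_def)

lemma expected_queries_point_test:
  fixes f :: "'a::linorder \<Rightarrow> 'r::linorder option"
  assumes "finite D" "D \<noteq> {}"
  shows "(\<integral>\<^sup>+t. of_nat (length (queries f t)) \<partial>point_test D) \<le> ennreal (1 + 2 * harm (card D))"
proof -
  let ?S = "D \<times> permutations_of_set D"
  let ?c = "\<lambda>(s, xs). length (queries f (point_test_tree s xs))"
  have S: "?S \<noteq> {}" "finite ?S" "real (card ?S) = real (card D) * fact (card D)"
    using assms by (auto simp: card_cartesian_product)
  have "(\<integral>\<^sup>+t. of_nat (length (queries f t)) \<partial>point_test D)
      = (\<Sum>p\<in>?S. of_nat (?c p)) / of_nat (card ?S)"
    using S(1,2) by (simp add: point_test_def nn_integral_pmf_of_set case_prod_beta)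
  also have "\<dots> = ennreal ((\<Sum>p\<in>?S. real (?c p)) / real (card ?S))"
    using S by (subst divide_ennreal[symmetric])
      (auto simp: ennreal_of_nat_eq_real_of_nat sum_nonneg card_gt_0_iff)
  also have "\<dots> \<le> ennreal (1 + 2 * harm (card D))"
  proof (rule ennreal_leI)
    have "(\<Sum>p\<in>?S. real (?c p)) \<le> real (card ?S) * (1 + 2 * harm (card D))"
      using sum_queries_point_test_tree[OF assms(1), of f] S(3) by (simp add: case_prod_beta)
    moreover have "real (card ?S) > 0"
      using S by (simp add: card_gt_0_iff)
    ultimately show "(\<Sum>p\<in>?S. real (?c p)) / real (card ?S) \<le> 1 + 2 * harm (card D)"
      by (simp add: pos_divide_le_eq mult.commute)
  qed
  finally show ?thesis .
qed

text \<open>The bound on rejecting points holds for every single ordering, so it survives averaging.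
  The factor \<open>1 - \<alpha>\<close> converts a fraction of the nonerased points into a fraction
  of \<open>D\<close>.\<close>

lemma prob_reject_point_test:
  fixes f :: "'a::linorder \<Rightarrow> 'r::linorder option"
  assumes "finite D" "D \<noteq> {}" "erased D \<alpha> f" "far D (mono_on D) \<epsilon> f" "0 \<le> \<epsilon>"
  shows "\<epsilon> * (1 - \<alpha>) \<le> prob_reject (point_test D) f"
proof -
  let ?Ps = "permutations_of_set D"
  let ?S = "D \<times> ?Ps"
  define R where "R = {(s, xs). \<not> verdict f (point_test_tree s xs)}"
  have S: "?S \<noteq> {}" "finite ?S" "real (card ?S) = real (card D) * fact (card D)"
    using assms by (auto simp: card_cartesian_product)
  have "\<epsilon> * (1 - \<alpha>) * real (card ?S) = (\<Sum>xs\<in>?Ps. \<epsilon> * ((1 - \<alpha>) * real (card D)))"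
    using assms S by simp
  also have "\<dots> \<le> (\<Sum>xs\<in>?Ps. \<epsilon> * real (card (nonerased D f)))"
    using assms by (intro sum_mono mult_left_mono card_nonerased)
  also have "\<dots> \<le> (\<Sum>xs\<in>?Ps. real (card {s \<in> D. (s, xs) \<in> R}))"
    using assms by (intro sum_mono) (simp add: R_def card_rejecting_points)
  also have "\<dots> = real (card (\<Union>xs\<in>?Ps. {s \<in> D. (s, xs) \<in> R} \<times> {xs}))"
    using assms by (subst card_UN_disjoint) (auto simp: card_cartesian_product)
  also have "(\<Union>xs\<in>?Ps. {s \<in> D. (s, xs) \<in> R} \<times> {xs}) = ?S \<inter> R"
    by auto
  finally have "\<epsilon> * (1 - \<alpha>) * real (card ?S) \<le> real (card (?S \<inter> R))" .
  moreover have "real (card ?S) > 0"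
    using S by (simp add: card_gt_0_iff)
  moreover have "prob_reject (point_test D) f = real (card (?S \<inter> R)) / real (card ?S)"
  proof -
    have "(\<lambda>(s, xs). point_test_tree s xs) -` {t. \<not> verdict f t} = R"
      by (auto simp: R_def)
    then show ?thesis
      using S by (simp add: prob_reject_def point_test_def measure_pmf_of_set)
  qed
  ultimately show ?thesis
    by (simp add: pos_le_divide_eq)
qed

section \<open>Amplification under a total query budget\<close>

lemma prob_reject_eq: "prob_reject T f = 1 - prob_accept T f"
proof -
  have "{t. \<not> verdict f t} = UNIV - {t. verdict f t}"
    by auto
  then show ?thesis
    using measure_pmf.prob_compl[of "{t. verdict f t}" T]
    by (simp add: prob_reject_def prob_accept_def)
qed

lemma nn_integral_replicate_pmf_sum_list:
  fixes c :: "'b \<Rightarrow> nat"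
  shows "(\<integral>\<^sup>+xs. of_nat (\<Sum>x\<leftarrow>xs. c x) \<partial>replicate_pmf k p) = of_nat k * (\<integral>\<^sup>+x. of_nat (c x) \<partial>p)"
  by (induction k) (simp_all add: nn_integral_add distrib_right)

lemma prob_replicate_pmf_all:
  "measure_pmf.prob (replicate_pmf k p) {xs. \<forall>x\<in>set xs. x \<in> A} = measure_pmf.prob p A ^ k"
proof -
  have ind: "indicator {xs. \<forall>x\<in>set xs. x \<in> A} (x # xs)
      = (indicator A x * indicator {xs. \<forall>x\<in>set xs. x \<in> A} xs :: ennreal)" for x xs
    by (auto simp: indicator_def)
  have "(\<integral>\<^sup>+xs. indicator {xs. \<forall>x\<in>set xs. x \<in> A} xs \<partial>replicate_pmf k p) = emeasure p A ^ k"
    by (induction k) (simp_all add: ind nn_integral_cmult nn_integral_multc)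
  then have "emeasure (replicate_pmf k p) {xs. \<forall>x\<in>set xs. x \<in> A} = emeasure p A ^ k"
    by simp
  then show ?thesis
    by (simp add: measure_pmf.emeasure_eq_measure ennreal_power)
qed

text \<open>The budget \<open>m\<close> is shared by all \<open>k\<close> runs, so only the expected
  total matters and a single long run does no harm.\<close>

definition amplify ::
    "nat \<Rightarrow> nat \<Rightarrow> ('x, 'v) query_algorithm \<Rightarrow> ('x, 'v) query_algorithm" where
  "amplify k m T = map_pmf (\<lambda>ts. truncate_tree (conj_trees ts) m) (replicate_pmf k T)"

text \<open>A union bound over two events of probability at most 1/6: all \<open>k\<close> runs
  accept, or together they need more than \<open>m\<close> queries.\<close>

lemma prob_reject_amplify:
  fixes T :: "('x, 'v) query_algorithm"
  assumes E: "(\<integral>\<^sup>+t. of_nat (length (queries f t)) \<partial>T) \<le> ennreal E" "0 \<le> E"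
    and "p \<le> prob_reject T f" "5 \<le> real k * p" "6 * (real k * E) \<le> real m + 1"
  shows "2 / 3 \<le> prob_reject (amplify k m T) f"
proof -
  let ?M = "replicate_pmf k T"
  define c where "c ts = (\<Sum>t\<leftarrow>ts. length (queries f t))" for ts
  let ?A = "{ts. \<forall>t\<in>set ts. t \<in> {t. verdict f t}}"
  let ?L = "{ts. m < c ts}"
  have "prob_accept T f \<le> 1 - p"
    using assms prob_reject_eq[of T f] by simp
  also have "\<dots> \<le> exp (- p)"
    using exp_ge_add_one_self[of "- p"] by simp
  finally have "prob_accept T f ^ k \<le> exp (- p) ^ k"
    by (intro power_mono) (simp_all add: prob_accept_def)
  also have "\<dots> = exp (- (real k * p))"
    by (simp add: exp_of_nat_mult[symmetric])
  also have "\<dots> \<le> exp (- 5)"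
    using assms by simp
  \<comment> \<open>From \<open>exp 5 \<ge> 1 + 5\<close>.\<close>
  also have "\<dots> \<le> 1 / 6"
    using exp_ge_add_one_self[of 5] by (simp add: exp_minus field_simps)
  finally have A: "measure_pmf.prob ?M ?A \<le> 1 / 6"
    by (simp add: prob_replicate_pmf_all prob_accept_def del: mem_Collect_eq)

  \<comment> \<open>Query counts are integers, so exceeding \<open>m\<close> means reaching
    \<open>m + 1\<close>. Using this threshold in Markov's inequality later absorbs the rounding of
    the budget.\<close>
  have "emeasure ?M ?L \<le> emeasure ?M {ts \<in> UNIV. 1 \<le> ennreal (1 / (real m + 1)) * of_nat (c ts)}"
  proof (rule emeasure_mono)
    have "1 \<le> ennreal (1 / (real m + 1)) * of_nat (c ts)" if "m < c ts" for ts
    proof -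
      have "real m + 1 \<le> real (c ts)"
        using that by linarith
      then have "1 \<le> 1 / (real m + 1) * real (c ts)"
        by (simp add: field_simps)
      then show ?thesis
        by (simp add: ennreal_of_nat_eq_real_of_nat ennreal_mult[symmetric] ennreal_1[symmetric]
            del: ennreal_1)
    qed
    then show "?L \<subseteq> {ts \<in> UNIV. 1 \<le> ennreal (1 / (real m + 1)) * of_nat (c ts)}"
      by auto
  qed simp
  also have "\<dots> \<le> ennreal (1 / (real m + 1)) * (\<integral>\<^sup>+ts. of_nat (c ts) * indicator UNIV ts \<partial>?M)"
    by (rule nn_integral_Markov_inequality) simp_all
  also have "\<dots> = ennreal (1 / (real m + 1)) * (of_nat k * (\<integral>\<^sup>+t. of_nat (length (queries f t)) \<partial>T))"
    unfolding c_def by (simp add: nn_integral_replicate_pmf_sum_list)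
  also have "\<dots> \<le> ennreal (1 / (real m + 1)) * (of_nat k * ennreal E)"
    by (intro mult_left_mono E) simp_all
  also have "\<dots> = ennreal (1 / (real m + 1) * (real k * E))"
    using E(2) by (simp add: ennreal_mult[symmetric] ennreal_of_nat_eq_real_of_nat)
  also have "\<dots> \<le> ennreal (1 / 6)"
    using assms by (intro ennreal_leI) (simp add: field_simps)
  finally have L: "measure_pmf.prob ?M ?L \<le> 1 / 6"
    by (simp add: measure_pmf.emeasure_eq_measure)

  have "prob_accept (amplify k m T) f
      = measure_pmf.prob ?M {ts. verdict f (truncate_tree (conj_trees ts) m)}"
    by (simp add: prob_accept_def amplify_def vimage_def)
  also have "\<dots> \<le> measure_pmf.prob ?M (?A \<union> ?L)"
  proof (rule measure_pmf.finite_measure_mono)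
    \<comment> \<open>Within the budget, truncation does not change the verdict.\<close>
    have "verdict f (conj_trees ts)"
      if "verdict f (truncate_tree (conj_trees ts) m)" "\<not> m < c ts" for ts
      using that length_queries_conj_trees[of f ts] verdict_truncate_tree_eq[of f "conj_trees ts" m]
      by (simp add: c_def)
    then show "{ts. verdict f (truncate_tree (conj_trees ts) m)} \<subseteq> ?A \<union> ?L"
      by (auto simp: verdict_conj_trees)
  qed simp
  also have "\<dots> \<le> measure_pmf.prob ?M ?A + measure_pmf.prob ?M ?L"
    by (rule measure_Un_le) simp_all
  finally show ?thesis
    using A L prob_reject_eq[of "amplify k m T" f] by simp
qed

lemma set_amplify_cases:
  assumes "t \<in> set_pmf (amplify k m T)"
  obtains ts where "t = truncate_tree (conj_trees ts) m" "set ts \<subseteq> set_pmf T"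
  using assms by (auto simp: amplify_def set_replicate_pmf)

lemma set_queries_amplify:
  assumes "\<forall>t\<in>set_pmf T. set (queries f t) \<subseteq> D"
  shows "\<forall>t\<in>set_pmf (amplify k m T). set (queries f t) \<subseteq> D"
proof
  fix t assume "t \<in> set_pmf (amplify k m T)"
  then obtain ts where ts: "t = truncate_tree (conj_trees ts) m" "set ts \<subseteq> set_pmf T"
    by (rule set_amplify_cases)
  have "set (queries f t) \<subseteq> (\<Union>t\<in>set ts. set (queries f t))"
    unfolding ts(1) using set_queries_truncate_tree set_queries_conj_trees by (rule subset_trans)
  then show "set (queries f t) \<subseteq> D"
    using assms ts(2) by blast
qed

lemma prob_accept_eq_1:
  assumes "\<forall>t\<in>set_pmf T. verdict f t"
  shows "prob_accept T f = 1"
  unfolding prob_accept_def using assms by (intro measure_pmf.prob_eq_1[THEN iffD2]) (auto simp: AE_measure_pmf_iff)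

lemma prob_accept_amplify_eq_1:
  assumes "\<forall>t\<in>set_pmf T. verdict f t"
  shows "prob_accept (amplify k m T) f = 1"
  using assms by (intro prob_accept_eq_1 ballI)
    (auto elim!: set_amplify_cases intro!: verdict_truncate_tree simp: verdict_conj_trees subset_iff)

lemma query_complexity_amplify: "query_complexity D \<alpha> (amplify k m T) \<le> enat m"
  unfolding query_complexity_def
  by (intro SUP_least) (auto elim!: set_amplify_cases simp: length_queries_truncate_tree)

lemma set_queries_point_test:
  assumes "finite D" "D \<noteq> {}"
  shows "\<forall>t\<in>set_pmf (point_test D). set (queries f t) \<subseteq> D"
proof -
  have "set (queries f (point_test_tree s xs)) \<subseteq> D"
    if "s \<in> D" "xs \<in> permutations_of_set D" for s xs
  proof -
    have "set (queries f (search_tree s a xs)) \<subseteq> D" for a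
      using set_queries_search_tree[of f s a xs] that by (simp add: permutations_of_setD)
    then show ?thesis
      using that by (simp add: point_test_tree_def split: option.split)
  qed
  then show ?thesis
    using assms by (auto simp: set_point_test)
qed

lemma verdict_point_test_if_restorable:
  assumes "finite D" "D \<noteq> {}" "restorable D (mono_on D) f"
  shows "\<forall>t\<in>set_pmf (point_test D). verdict f t"
proof -
  obtain f' where f': "restoration D f f'" "mono_on D f'"
    using assms(3) by (auto simp: restorable_def)
  have eq: "f' x = b" if "x \<in> D" "f x = Some b" for x b
    using f'(1) that by (auto simp: restoration_def nonerased_def)
  have "verdict f (point_test_tree s xs)" if s: "s \<in> D" and xs: "xs \<in> permutations_of_set D" for s xs
  proof -
    have "verdict f (search_tree s a xs)" if "f s = Some a" for a
    proof (rule verdict_search_tree_if_mono, intro ballI allI impI)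
      fix x b assume "x \<in> set xs" "f x = Some b"
      then have "x \<in> D" "f' x = b" "f' s = a"
        using xs s that eq by (auto simp: permutations_of_setD)
      then show "(x \<le> s \<longrightarrow> b \<le> a) \<and> (s \<le> x \<longrightarrow> a \<le> b)"
        using s mono_onD[OF f'(2)] by blast
    qed
    then show ?thesis
      by (simp add: point_test_tree_def split: option.split)
  qed
  then show ?thesis
    using assms by (auto simp: set_point_test)
qed

section \<open>Choice of parameters and conclusion\<close>

text \<open>The sequence \<open>harm n - ln n\<close> is decreasing and starts with 1 at
  \<open>n = 1\<close>.\<close>

lemma harm_le_ln: "0 < n \<Longrightarrow> harm n \<le> 1 + ln (real n)"
  using euler_mascheroni_sequence_decreasing[of 1 n] by (simp add: harm_expand)

text \<open>For \<open>n = 1\<close> the bound \<open>log 2 n\<close> is 0, so no query is allowed.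
  Accepting blindly is correct there: the only point is nonerased, and every function on it is
  monotone.\<close>

lemma not_far_if_card_eq_1:
  fixes f :: "'a::linorder \<Rightarrow> 'r::linorder option"
  assumes "finite D" "card D = 1" "erased D \<alpha> f" "\<alpha> < 1" "0 < \<epsilon>"
  shows "\<not> far D (mono_on D) \<epsilon> f"
proof
  assume far: "far D (mono_on D) \<epsilon> f"
  obtain d where D: "D = {d}"
    using assms(2) by (auto simp: card_1_singleton_iff)
  define f' where "f' = (\<lambda>x. the (f x))"
  have "restoration D f f'" "mono_on D f'"
    by (auto simp: restoration_def nonerased_def f'_def D monotone_on_def)
  with far have "\<epsilon> * real (card (nonerased D f)) \<le> real (card {x \<in> nonerased D f. f' x \<noteq> f' x})"
    unfolding far_def by blast
  moreover have "0 < real (card (nonerased D f))"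
    using card_nonerased[OF assms(1,3)] assms(2,4) by simp
  ultimately show False
    using \<open>0 < \<epsilon>\<close> by (simp add: mult_le_0_iff)
qed

theorem theorem1p4:
  shows "\<exists>T :: nat \<Rightarrow> real \<Rightarrow> real \<Rightarrow> (nat, real option) query_algorithm.
    (\<forall>n \<alpha> \<epsilon>. 1 \<le> n \<and> \<alpha> \<in> {0<..<1} \<and> \<epsilon> \<in> {0<..<1} \<longrightarrow>
        erasure_resilient_tester {1..n} (\<lambda>f :: nat \<Rightarrow> real. mono_on {1..n} f) \<alpha> \<epsilon> (T n \<alpha> \<epsilon>) \<and>
        one_sided {1..n} (\<lambda>f :: nat \<Rightarrow> real. mono_on {1..n} f) \<alpha> (T n \<alpha> \<epsilon>)) \<and>
    (\<exists>C > 0. \<forall>n \<alpha> \<epsilon>. 1 \<le> n \<and> \<alpha> \<in> {0<..<1} \<and> \<epsilon> \<in> {0<..<1} \<longrightarrow>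
        ereal_of_enat (query_complexity {1..n} \<alpha> (T n \<alpha> \<epsilon>))
          \<le> ereal (C * (log 2 (real n) / (\<epsilon> * (1 - \<alpha>)))))"
proof -
  \<comment> \<open>180 is 6 * 6 * 5: a factor 6 for Markov's inequality, at most
    \<open>6 / (\<epsilon> * (1 - \<alpha>))\<close> runs, and on average at most
    \<open>5 * log 2 n\<close> queries per run when \<open>n \<ge> 2\<close>.\<close>
  define budget :: "nat \<Rightarrow> real \<Rightarrow> real \<Rightarrow> real"
    where "budget n \<alpha> \<epsilon> = 180 * (log 2 (real n) / (\<epsilon> * (1 - \<alpha>)))" for n \<alpha> \<epsilon>
  define runs :: "real \<Rightarrow> real \<Rightarrow> nat" where "runs \<alpha> \<epsilon> = nat \<lceil>5 / (\<epsilon> * (1 - \<alpha>))\<rceil>" for \<alpha> \<epsilon>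
  define T :: "nat \<Rightarrow> real \<Rightarrow> real \<Rightarrow> (nat, real option) query_algorithm"
    where "T n \<alpha> \<epsilon> = amplify (runs \<alpha> \<epsilon>) (nat \<lfloor>budget n \<alpha> \<epsilon>\<rfloor>) (point_test {1..n})" for n \<alpha> \<epsilon>
  have accept: "prob_accept (T n \<alpha> \<epsilon>) f = 1"
    if "1 \<le> n" "restorable {1..n} (mono_on {1..n}) f" for n \<alpha> \<epsilon> f
    unfolding T_def using that
    by (intro prob_accept_amplify_eq_1 verdict_point_test_if_restorable) simp_all
  have reject: "2 / 3 \<le> prob_reject (T n \<alpha> \<epsilon>) f"
    if "1 \<le> n" and \<alpha>: "0 < \<alpha>" "\<alpha> < 1" and \<epsilon>: "0 < \<epsilon>" "\<epsilon> < 1"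
      and f: "erased {1..n} \<alpha> f" "far {1..n} (mono_on {1..n}) \<epsilon> f" for n \<alpha> \<epsilon> f
  proof (cases "n = 1")
    case True
    then show ?thesis
      using not_far_if_card_eq_1[of "{1..n}" \<alpha> f \<epsilon>] that by simp
  next
    case False
    define q where "q = \<epsilon> * (1 - \<alpha>)"
    define L where "L = log 2 (real n)"
    have q: "0 < q" "q \<le> 1"
      using \<alpha> \<epsilon> by (auto simp: q_def intro!: mult_le_one)
    have n: "2 \<le> n"
      using False \<open>1 \<le> n\<close> by simp
    have "1 \<le> L"
      using n by (simp add: L_def le_log_iff)
    have "ln (real n) = L * ln 2"
      using n by (simp add: L_def log_def)
    also have "\<dots> \<le> L"
      using \<open>1 \<le> L\<close> ln_le_minus_one[of 2] by (simp add: mult_left_le)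
    \<comment> \<open>The left side is at most \<open>3 + 2 * ln n\<close>, and
      \<open>1 \<le> L\<close> absorbs the constant.\<close>
    finally have E: "1 + 2 * harm n \<le> 5 * L"
      using harm_le_ln[of n] n \<open>1 \<le> L\<close> by simp
    have lo: "5 / q \<le> real (runs \<alpha> \<epsilon>)"
      unfolding runs_def q_def[symmetric] by linarith
    have "0 \<le> 5 / q" "1 \<le> 1 / q"
      using q by simp_all
    then have "real (runs \<alpha> \<epsilon>) \<le> 5 / q + 1"
      unfolding runs_def q_def[symmetric] by linarith
    \<comment> \<open>As \<open>q \<le> 1\<close>, the loss from rounding up is at most
      \<open>1 / q\<close>.\<close>
    also have "\<dots> \<le> 6 / q"
      using q by (simp add: field_simps)
    finally have hi: "real (runs \<alpha> \<epsilon>) \<le> 6 / q" .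
    show ?thesis
      unfolding T_def
    proof (rule prob_reject_amplify)
      show "(\<integral>\<^sup>+t. of_nat (length (queries f t)) \<partial>point_test {1..n}) \<le> ennreal (1 + 2 * harm n)"
        using expected_queries_point_test[of "{1..n}" f] n by simp
      show "0 \<le> 1 + 2 * (harm n :: real)"
        using harm_nonneg[of n, where 'a = real] by simp
      show "q \<le> prob_reject (point_test {1..n}) f"
        unfolding q_def using f n \<epsilon> by (intro prob_reject_point_test) simp_all
      show "5 \<le> real (runs \<alpha> \<epsilon>) * q"
        using lo q by (simp add: field_simps)
      have "real (runs \<alpha> \<epsilon>) * (1 + 2 * harm n) \<le> 6 / q * (5 * L)"
        using hi E q harm_nonneg[of n, where 'a = real] by (intro mult_mono) simp_all
      then have "6 * (real (runs \<alpha> \<epsilon>) * (1 + 2 * harm n)) \<le> budget n \<alpha> \<epsilon>"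
        by (simp add: budget_def q_def L_def)
      \<comment> \<open>Rounding down loses less than one query, which the threshold
        \<open>m + 1\<close> makes up for.\<close>
      also have "\<dots> \<le> real (nat \<lfloor>budget n \<alpha> \<epsilon>\<rfloor>) + 1"
        by linarith
      finally show "6 * (real (runs \<alpha> \<epsilon>) * (1 + 2 * harm n)) \<le> real (nat \<lfloor>budget n \<alpha> \<epsilon>\<rfloor>) + 1" .
    qed
  qed
  have "\<forall>t\<in>set_pmf (T n \<alpha> \<epsilon>). set (queries f t) \<subseteq> {1..n}" if "1 \<le> n" for n \<alpha> \<epsilon> f
    unfolding T_def using that by (intro set_queries_amplify set_queries_point_test) simp_all
  with accept reject have "erasure_resilient_tester {1..n} (mono_on {1..n}) \<alpha> \<epsilon> (T n \<alpha> \<epsilon>)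
      \<and> one_sided {1..n} (mono_on {1..n}) \<alpha> (T n \<alpha> \<epsilon>)"
    if "1 \<le> n" "\<alpha> \<in> {0<..<1}" "\<epsilon> \<in> {0<..<1}" for n \<alpha> \<epsilon>
    using that by (simp add: erasure_resilient_tester_def one_sided_def)
  moreover have "ereal_of_enat (query_complexity {1..n} \<alpha> (T n \<alpha> \<epsilon>)) \<le> ereal (budget n \<alpha> \<epsilon>)"
    if "1 \<le> n" "\<alpha> \<in> {0<..<1}" "\<epsilon> \<in> {0<..<1}" for n \<alpha> \<epsilon>
  proof -
    have "ereal_of_enat (query_complexity {1..n} \<alpha> (T n \<alpha> \<epsilon>))
        \<le> ereal_of_enat (enat (nat \<lfloor>budget n \<alpha> \<epsilon>\<rfloor>))"
      by (simp only: T_def ereal_of_enat_le_iff query_complexity_amplify)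
    also have "\<dots> \<le> ereal (budget n \<alpha> \<epsilon>)"
      using that by (simp add: budget_def)
    finally show ?thesis .
  qed
  moreover have "(0 :: real) < 180"
    by simp
  ultimately show ?thesis
    unfolding budget_def by blast
qed

end
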